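(* Let $P$ be a finite poset and let $l$ be a positive integer. For every fixed positive integer $t$ and every positive integer $n$, \[ \operatorname{RT}(\mathcal{B}; n, P, l, t)\le \operatorname{RT}^{\sharp}(\mathcal{B}; n, P, l, t)\le \begin{cases} 0 & \text{if } l=1,\\ \displaystyle\sum_{i=1}^{\min(t,l-1)} \binom{l-1}{i}\binom{i(n+1)}{t} & \text{if } l\ge 2. \end{cases} \] Moreover, as $n\to\infty$ with $t$ and $l$ fixed, \[ \operatorname{RT}^{\sharp}(\mathcal{B}; n, P, l, t)\le \left(\frac{1}{t!}\sum_{i=1}^{\min(t,l-1)}\binom{l-1}{i}i^t\right)n^t+O(n^{t-1}). \] For the special case $t=1$, this reduces to $\operatorname{RT}^{\sharp}(\mathcal{B}; n, P, l, 1)\le (l-1)\cdot n+O(1)$.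
   Context: $B_n$ is the power set of $[n]=\{1,\dots,n\}$ ordered by inclusion; a subset $Q\subseteq B_n$ (possibly empty) is regarded as a poset with the induced order. A $t$-chain in a poset is a set of exactly $t$ distinct pairwise comparable elements, and $\mathcal{C}_t(Q)$ is the set of all $t$-chains of $Q$. The width $w(Q)$ is the size of a largest antichain of $Q$ (with $w(\emptyset)=0$). An injection $f:P\to Q$ between posets is a weak embedding if $x\le y$ in $P$ implies $f(x)\le f(y)$ in $Q$, and a strong embedding if $x\le y$ in $P$ if and only if $f(x)\le f(y)$ in $Q$. $Q$ is weakly (resp. strongly) $P$-free if there is no weak (resp. strong) embedding of $P$ into $Q$. For positive integers $n,l,t$, $\operatorname{RT}(\mathcal{B};n,P,l,t)$ (resp. $\operatorname{RT}^{\sharp}(\mathcal{B};n,P,l,t)$) is the maximum of $|\mathcal{C}_t(Q)|$ over all $Q\subseteq B_n$ such that $Q$ is weakly (resp. strongly) $P$-free and $w(Q)<l$. The forbidden poset $P$ is nonempty, so that the maximum is over a nonempty family. *)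

theory Defs
  imports Complex_Main "HOL-Library.Landau_Symbols"
begin

text \<open>
  A poset is given by a carrier set and an order relation on it, as in \<^const>\<open>partial_order_on\<close>.
\<close>

definition weak_embedding ::
  "('a \<Rightarrow> 'b) \<Rightarrow> 'a set \<Rightarrow> 'a rel \<Rightarrow> 'b set \<Rightarrow> 'b rel \<Rightarrow> bool" where
  "weak_embedding f P r Q s \<longleftrightarrow>
     inj_on f P \<and> f ` P \<subseteq> Q \<and> (\<forall>x\<in>P. \<forall>y\<in>P. (x, y) \<in> r \<longrightarrow> (f x, f y) \<in> s)"

definition strong_embedding ::
  "('a \<Rightarrow> 'b) \<Rightarrow> 'a set \<Rightarrow> 'a rel \<Rightarrow> 'b set \<Rightarrow> 'b rel \<Rightarrow> bool" where
  "strong_embedding f P r Q s \<longleftrightarrow>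
     inj_on f P \<and> f ` P \<subseteq> Q \<and> (\<forall>x\<in>P. \<forall>y\<in>P. (x, y) \<in> r \<longleftrightarrow> (f x, f y) \<in> s)"

definition weakly_free :: "'a set \<Rightarrow> 'a rel \<Rightarrow> 'b set \<Rightarrow> 'b rel \<Rightarrow> bool" where
  "weakly_free P r Q s \<longleftrightarrow> \<not> (\<exists>f. weak_embedding f P r Q s)"

definition strongly_free :: "'a set \<Rightarrow> 'a rel \<Rightarrow> 'b set \<Rightarrow> 'b rel \<Rightarrow> bool" where
  "strongly_free P r Q s \<longleftrightarrow> \<not> (\<exists>f. strong_embedding f P r Q s)"

definition t_chains :: "nat \<Rightarrow> 'a set \<Rightarrow> 'a rel \<Rightarrow> 'a set set" where
  "t_chains t Q s =
     {C. C \<subseteq> Q \<and> finite C \<and> card C = t \<and> (\<forall>x\<in>C. \<forall>y\<in>C. (x, y) \<in> s \<or> (y, x) \<in> s)}"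

definition antichain :: "'a set \<Rightarrow> 'a rel \<Rightarrow> 'a set \<Rightarrow> bool" where
  "antichain Q s A \<longleftrightarrow>
     A \<subseteq> Q \<and> (\<forall>x\<in>A. \<forall>y\<in>A. x \<noteq> y \<longrightarrow> (x, y) \<notin> s \<and> (y, x) \<notin> s)"

text \<open>Only meaningful for finite posets; the empty antichain makes the width of the empty poset 0.\<close>

definition width :: "'a set \<Rightarrow> 'a rel \<Rightarrow> nat" where
  "width Q s = Max {card A | A. antichain Q s A}"

definition boolean_lattice :: "nat \<Rightarrow> nat set set" where
  "boolean_lattice n = Pow {1..n}"

definition incl :: "nat set set \<Rightarrow> nat set rel" where
  "incl Q = relation_of (\<subseteq>) Q"

text \<open>
  The maxima below range over finite sets of numbers. For nonempty \<^term>\<open>P\<close> and \<^term>\<open>l > 0\<close> these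
  sets are nonempty, since the empty family \<^term>\<open>Q\<close> is then admissible; otherwise the values are
  not meaningful.
\<close>

definition RT :: "nat \<Rightarrow> 'a set \<Rightarrow> 'a rel \<Rightarrow> nat \<Rightarrow> nat \<Rightarrow> nat" where
  "RT n P r l t =
     Max {card (t_chains t Q (incl Q)) | Q.
            Q \<subseteq> boolean_lattice n \<and> weakly_free P r Q (incl Q) \<and> width Q (incl Q) < l}"

definition RT_sharp :: "nat \<Rightarrow> 'a set \<Rightarrow> 'a rel \<Rightarrow> nat \<Rightarrow> nat \<Rightarrow> nat" where
  "RT_sharp n P r l t =
     Max {card (t_chains t Q (incl Q)) | Q.
            Q \<subseteq> boolean_lattice n \<and> strongly_free P r Q (incl Q) \<and> width Q (incl Q) < l}"

end

theory Submission
  imports Defs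
begin

text \<open>
  By Dilworth's theorem (\<open>dilworth\<close>) a family of width less than \<open>l\<close> is the union of \<open>l - 1\<close>
  chains, and a chain in the Boolean lattice has at most \<open>n + 1\<close> members, because its members
  have distinct cardinalities between \<open>0\<close> and \<open>n\<close>. Now sort the \<open>t\<close>-chains of the family by
  the set of chains of the decomposition that they meet. If there are \<open>i\<close> of these, then
  \<open>1 \<le> i \<le> min t (l - 1)\<close>, they can be chosen in \<open>(l - 1) choose i\<close> ways, and the \<open>t\<close>-chain is
  one of the \<open>t\<close>-subsets of their union, which has at most \<open>i * (n + 1)\<close> members
  (\<open>card_subsets_coloured_le\<close>). This is the explicit bound.

  The asymptotic bound follows from \<open>m choose t \<le> m ^ t / fact t\<close> and from
  \<open>(n + 1) ^ t = n ^ t + O(n ^ (t - 1))\<close>. A strong embedding is a weak one, so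
  \<open>RT\<close> maximises over a subfamily of the families admitted for \<open>RT_sharp\<close>.
\<close>

section \<open>Dilworth's theorem\<close>

text \<open>
  A decomposition into \<open>k\<close> chains is encoded as a colouring whose colour classes are chains.
  The chains are then automatically disjoint. The colouring is injective on every antichain, so an
  antichain of size \<open>k\<close> meets every class.

  The proof is Galvin's: remove a maximal element \<open>a\<close>. If the rest \<open>Q'\<close> has no antichain of size
  \<open>k\<close>, it needs only \<open>k - 1\<close> colours and \<open>a\<close> gets its own. Otherwise colour \<open>Q'\<close> with \<open>k\<close> colours. In each class take the greatest element that lies in some \<open>k\<close>-antichain of \<open>Q'\<close>. These elements
  form a \<open>k\<close>-antichain, so \<open>a\<close> must lie above one of them, say \<open>u\<close>. The part of the class of \<open>u\<close>
  below \<open>u\<close>, together with \<open>a\<close>, is a chain that meets every \<open>k\<close>-antichain of \<open>Q\<close>, hence the rest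
  of \<open>Q\<close> can be coloured with \<open>k - 1\<close> colours.
\<close>

theorem dilworth:
  fixes Q :: "'a::order set"
  assumes "finite Q"
    and "\<And>A. A \<subseteq> Q \<Longrightarrow> \<forall>x\<in>A. \<forall>y\<in>A. x \<le> y \<longrightarrow> x = y \<Longrightarrow> card A \<le> k"
  shows "\<exists>f. f ` Q \<subseteq> {..<k} \<and> (\<forall>x\<in>Q. \<forall>y\<in>Q. f x = f y \<longrightarrow> x \<le> y \<or> y \<le> x)"
  using assms
proof (induction "card Q" arbitrary: Q k rule: less_induct)
  case less
  define anti where "anti A \<longleftrightarrow> (\<forall>x\<in>A. \<forall>y\<in>A. x \<le> y \<longrightarrow> x = y)" for A :: "'a set"
  define good where "good R k f \<longleftrightarrow>
      f ` R \<subseteq> {..<k} \<and> (\<forall>x\<in>R. \<forall>y\<in>R. f x = f y \<longrightarrow> x \<le> y \<or> y \<le> x)"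
    for R :: "'a set" and k :: nat and f :: "'a \<Rightarrow> nat"
  have fin: "finite Q" by (rule less.prems)
  have bound: "card A \<le> k" if "A \<subseteq> Q" "anti A" for A
    using less.prems(2) that unfolding anti_def by blast
  have colouring: "\<exists>f. good R m f"
    if "R \<subset> Q" "\<And>A. A \<subseteq> R \<Longrightarrow> anti A \<Longrightarrow> card A \<le> m" for R m
    unfolding good_def
    by (rule less.hyps) (use that psubset_card_mono[OF fin] finite_subset[OF _ fin] in
        \<open>auto simp: anti_def\<close>)
  \<comment> \<open>If removing a chain destroys every antichain of size \<open>k\<close>, the chain can be one colour class.\<close>
  have add_chain: "\<exists>f. good Q k f"
    if K: "K \<subseteq> Q" "K \<noteq> {}" "\<forall>x\<in>K. \<forall>y\<in>K. x \<le> y \<or> y \<le> x"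
      and meets: "\<And>A. A \<subseteq> Q - K \<Longrightarrow> anti A \<Longrightarrow> card A \<noteq> k" for K
  proof -
    obtain x where "x \<in> K" using K by blast
    have "card {x} \<le> k" by (rule bound) (use K \<open>x \<in> K\<close> in \<open>auto simp: anti_def\<close>)
    then have "k > 0" by simp
    have "card A \<le> k - 1" if "A \<subseteq> Q - K" "anti A" for A
      using bound[of A] meets[of A] that by force
    moreover have "Q - K \<subset> Q" using K by blast
    ultimately obtain g where g: "good (Q - K) (k - 1) g" using colouring by blast
    define f where "f = (\<lambda>x. if x \<in> K then k - 1 else g x)"
    have g_less: "g x < k - 1" if "x \<in> Q" "x \<notin> K" for x
      using g that unfolding good_def by auto
    have "f ` Q \<subseteq> {..<k}"
      using g_less \<open>k > 0\<close> by (force simp: f_def)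
    moreover have "x \<le> y \<or> y \<le> x" if "x \<in> Q" "y \<in> Q" "f x = f y" for x y
      using that g_less[of x] g_less[of y] K(3) g unfolding good_def f_def
      by (auto split: if_splits)
    ultimately show ?thesis unfolding good_def by blast
  qed
  have "\<exists>f. good Q k f"
  proof (cases "Q = {}")
    case True
    then show ?thesis by (simp add: good_def)
  next
    case False
    then obtain a where a: "a \<in> Q" and a_max: "\<And>x. x \<in> Q \<Longrightarrow> a \<le> x \<Longrightarrow> a = x"
      using finite_has_maximal[OF fin] by auto
    define Q' where "Q' = Q - {a}"
    have finQ': "finite Q'" using fin by (simp add: Q'_def)
    show ?thesis
    proof (cases "\<exists>A\<subseteq>Q'. anti A \<and> card A = k")
      case False
      then show ?thesis using a by (intro add_chain[of "{a}"]) (auto simp: Q'_def)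
    next
      case True
      then obtain A0 where A0: "A0 \<subseteq> Q'" "anti A0" "card A0 = k" by blast
      have "\<exists>f. good Q' k f"
        using a by (intro colouring bound) (auto simp: Q'_def)
      then obtain f where f: "good Q' k f" by blast
      have f_chain: "x \<le> y \<or> y \<le> x" if "x \<in> Q'" "y \<in> Q'" "f x = f y" for x y
        using f that unfolding good_def by blast
      have meets: "\<exists>x\<in>A. f x = i" if A: "A \<subseteq> Q'" "anti A" "card A = k" and "i < k" for A i
      proof -
        have "inj_on f A"
          using A f_chain unfolding inj_on_def anti_def by (metis subsetD)
        then have "card (f ` A) = k" using A by (simp add: card_image)
        moreover have "f ` A \<subseteq> {..<k}" using f A unfolding good_def by blast
        ultimately have "f ` A = {..<k}" by (intro card_subset_eq) auto
        then show ?thesis using \<open>i < k\<close> by (metis imageE lessThan_iff)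
      qed
      define S where "S i = {x \<in> Q'. f x = i \<and> (\<exists>A\<subseteq>Q'. anti A \<and> card A = k \<and> x \<in> A)}" for i
      have "\<exists>x\<in>S i. \<forall>y\<in>S i. y \<le> x" if "i < k" for i
      proof -
        have "S i \<noteq> {}" using meets[OF A0 that] A0 unfolding S_def by blast
        moreover have "finite (S i)" using finQ' by (simp add: S_def)
        ultimately obtain x where x: "x \<in> S i" "\<And>y. y \<in> S i \<Longrightarrow> x \<le> y \<Longrightarrow> x = y"
          using finite_has_maximal by metis
        have "y \<le> x" if "y \<in> S i" for y
          using f_chain[of x y] x that by (auto simp: S_def)
        then show ?thesis using x by blast
      qed
      then obtain u where u: "\<And>i. i < k \<Longrightarrow> u i \<in> S i"
        and u_max: "\<And>i y. i < k \<Longrightarrow> y \<in> S i \<Longrightarrow> y \<le> u i"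
        by metis
      \<comment> \<open>A \<open>k\<close>-antichain through \<open>u j\<close> meets class \<open>i\<close> in some \<open>y \<le> u i\<close>, so \<open>u i \<le> u j\<close> would
        make \<open>y\<close> and \<open>u j\<close> comparable.\<close>
      have u_anti: "i = j" if ij: "i < k" "j < k" "u i \<le> u j" for i j
      proof -
        obtain A where A: "A \<subseteq> Q'" "anti A" "card A = k" "u j \<in> A"
          using u[OF ij(2)] by (auto simp: S_def)
        obtain y where y: "y \<in> A" "f y = i" using meets[OF A(1-3) ij(1)] by blast
        then have "y \<in> S i" using A by (auto simp: S_def)
        then have "y \<le> u j" using u_max ij order_trans by blast
        then have "y = u j" using A y unfolding anti_def by blast
        then show ?thesis using y u[OF ij(2)] by (simp add: S_def)
      qed
      define U where "U = u ` {..<k}"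
      have UQ: "U \<subseteq> Q'" using u by (auto simp: U_def S_def)
      have "inj_on u {..<k}" using u_anti by (auto simp: inj_on_def)
      then have "card (insert a U) = Suc k"
        using UQ by (simp add: U_def Q'_def card_image card_insert_if subset_Diff_insert)
      then have "\<not> anti (insert a U)"
        using bound[of "insert a U"] UQ a by (auto simp: Q'_def)
      moreover have "anti U" using u_anti by (auto simp: anti_def U_def)
      ultimately have "\<exists>x\<in>U. x \<le> a"
        using UQ a_max unfolding anti_def Q'_def by blast
      then obtain i where i: "i < k" "u i \<le> a" by (auto simp: U_def)
      define K where "K = insert a {z \<in> Q'. f z = i \<and> z \<le> u i}"
      show ?thesis
      proof (rule add_chain)
        show "K \<subseteq> Q" "K \<noteq> {}" using a by (auto simp: K_def Q'_def)
        show "\<forall>x\<in>K. \<forall>y\<in>K. x \<le> y \<or> y \<le> x"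
          using f_chain i by (auto simp: K_def intro: order_trans)
        show "card A \<noteq> k" if A: "A \<subseteq> Q - K" "anti A" for A
        proof
          assume "card A = k"
          have "A \<subseteq> Q'" using A by (auto simp: K_def Q'_def)
          then obtain y where y: "y \<in> A" "f y = i"
            using meets A \<open>card A = k\<close> i by blast
          then have "y \<in> S i" using \<open>A \<subseteq> Q'\<close> A \<open>card A = k\<close> by (auto simp: S_def)
          then have "y \<in> K" using u_max[OF i(1)] by (auto simp: K_def S_def)
          then show False using y A by blast
        qed
      qed
    qed
  qed
  then show ?case unfolding good_def .
qed

section \<open>Counting chains in families of bounded width\<close>

text \<open>
  The \<open>t\<close>-subsets are sorted by the set \<open>I\<close> of colours that they use: those with colour set \<open>I\<close>
  are \<open>t\<close>-subsets of the union of \<open>card I\<close> colour classes.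
\<close>

lemma card_subsets_coloured_le:
  fixes f :: "'a \<Rightarrow> nat"
  assumes "finite Q" "f ` Q \<subseteq> {..<k}" "t > 0"
    and class_size: "\<And>c. c < k \<Longrightarrow> card {x \<in> Q. f x = c} \<le> m"
  shows "card {C. C \<subseteq> Q \<and> card C = t} \<le> (\<Sum>i=1..min t k. (k choose i) * ((i * m) choose t))"
proof -
  define J where "J i = {I. I \<subseteq> {..<k} \<and> card I = i}" for i
  define T where "T I = {C. C \<subseteq> {x \<in> Q. f x \<in> I} \<and> card C = t}" for I
  have finJ: "finite (J i)" for i by (simp add: J_def)
  have finT: "finite (T I)" for I using \<open>finite Q\<close> by (simp add: T_def)
  have cardT: "card (T I) \<le> (i * m) choose t" if "I \<in> J i" for I i
  proof -
    have I: "I \<subseteq> {..<k}" "card I = i" "finite I"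
      using that by (auto simp: J_def intro: finite_subset)
    have "{x \<in> Q. f x \<in> I} = (\<Union>c\<in>I. {x \<in> Q. f x = c})" by blast
    then have "card {x \<in> Q. f x \<in> I} \<le> (\<Sum>c\<in>I. card {x \<in> Q. f x = c})"
      using card_UN_le[OF I(3)] by metis
    also have "\<dots> \<le> (\<Sum>c\<in>I. m)" using I class_size by (intro sum_mono) auto
    also have "\<dots> = i * m" using I by simp
    finally show ?thesis
      using \<open>finite Q\<close> by (simp add: T_def n_subsets binomial_right_mono)
  qed
  have "{C. C \<subseteq> Q \<and> card C = t} \<subseteq> (\<Union>i\<in>{1..min t k}. \<Union>I\<in>J i. T I)"
  proof
    fix C assume "C \<in> {C. C \<subseteq> Q \<and> card C = t}"
    then have C: "C \<subseteq> Q" "card C = t" by auto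
    then have "finite C" "C \<noteq> {}" using \<open>t > 0\<close> card_ge_0_finite by auto
    have "f ` C \<subseteq> {..<k}" using C assms(2) by blast
    moreover have "card (f ` C) \<le> t" using C card_image_le \<open>finite C\<close> by blast
    moreover have "card (f ` C) \<le> k"
      using card_mono[OF _ \<open>f ` C \<subseteq> {..<k}\<close>] by simp
    moreover have "card (f ` C) \<ge> 1"
      using \<open>finite C\<close> \<open>C \<noteq> {}\<close> by (simp add: Suc_leI card_gt_0_iff)
    moreover have "C \<in> T (f ` C)" using C by (auto simp: T_def)
    ultimately show "C \<in> (\<Union>i\<in>{1..min t k}. \<Union>I\<in>J i. T I)"
      unfolding J_def by (intro UN_I[of "card (f ` C)"] UN_I[of "f ` C"]) auto
  qed
  then have "card {C. C \<subseteq> Q \<and> card C = t} \<le> card (\<Union>i\<in>{1..min t k}. \<Union>I\<in>J i. T I)"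
    using finJ finT by (intro card_mono) auto
  also have "\<dots> \<le> (\<Sum>i\<in>{1..min t k}. card (\<Union>I\<in>J i. T I))"
    by (rule card_UN_le) simp
  also have "\<dots> \<le> (\<Sum>i\<in>{1..min t k}. \<Sum>I\<in>J i. card (T I))"
    using finJ by (intro sum_mono card_UN_le)
  also have "\<dots> \<le> (\<Sum>i\<in>{1..min t k}. \<Sum>I\<in>J i. (i * m) choose t)"
    using cardT by (intro sum_mono)
  also have "\<dots> = (\<Sum>i=1..min t k. (k choose i) * ((i * m) choose t))"
    by (simp add: J_def n_subsets)
  finally show ?thesis .
qed

text \<open>The members of a chain of sets are determined by their cardinalities.\<close>

lemma card_chain_boolean_lattice_le:
  assumes "K \<subseteq> boolean_lattice n" "\<forall>x\<in>K. \<forall>y\<in>K. x \<subseteq> y \<or> y \<subseteq> x"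
  shows "card K \<le> n + 1"
proof -
  have fin: "finite x" if "x \<in> K" for x
    using assms(1) that by (auto simp: boolean_lattice_def intro: finite_subset)
  have "inj_on card K"
    using assms(2) fin by (metis inj_onI card_subset_eq)
  moreover have "card ` K \<subseteq> {0..n}"
    using assms(1) card_mono[of "{1..n}"] unfolding boolean_lattice_def by force
  ultimately show ?thesis using card_inj_on_le[of card K "{0..n}"] by simp
qed

lemma card_antichain_le_width:
  assumes "finite Q" "antichain Q s A"
  shows "card A \<le> width Q s"
proof -
  have "finite {card A | A. antichain Q s A}"
    by (rule finite_subset[of _ "card ` Pow Q"]) (auto simp: antichain_def assms)
  then show ?thesis using assms(2) unfolding width_def by (intro Max_ge) auto
qed

lemma width_empty: "width {} s = 0"
proof -
  have "{card A | A. antichain {} s A} = {0}" by (auto simp: antichain_def)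
  then show ?thesis by (simp add: width_def)
qed

theorem card_t_chains_le:
  assumes "Q \<subseteq> boolean_lattice n" "width Q (incl Q) < l" "t > 0"
  shows "card (t_chains t Q (incl Q)) \<le>
           (\<Sum>i=1..min t (l - 1). ((l - 1) choose i) * ((i * (n + 1)) choose t))"
proof -
  have fin: "finite Q"
    using assms(1) by (rule finite_subset) (simp add: boolean_lattice_def)
  have "card A \<le> l - 1" if "A \<subseteq> Q" "\<forall>x\<in>A. \<forall>y\<in>A. x \<subseteq> y \<longrightarrow> x = y" for A
  proof -
    have "antichain Q (incl Q) A"
      using that by (auto simp: antichain_def incl_def relation_of_def)
    then show ?thesis using card_antichain_le_width[OF fin] assms(2) by fastforce
  qed
  then obtain f where f: "f ` Q \<subseteq> {..<l - 1}"
    "\<forall>x\<in>Q. \<forall>y\<in>Q. f x = f y \<longrightarrow> x \<subseteq> y \<or> y \<subseteq> x"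
    using dilworth[OF fin, of "l - 1"] by metis
  have "card {x \<in> Q. f x = c} \<le> n + 1" for c
    using f(2) assms(1) by (intro card_chain_boolean_lattice_le) blast+
  then have "card {C. C \<subseteq> Q \<and> card C = t} \<le>
      (\<Sum>i=1..min t (l - 1). ((l - 1) choose i) * ((i * (n + 1)) choose t))"
    by (intro card_subsets_coloured_le[OF fin f(1) assms(3)])
  moreover have "card (t_chains t Q (incl Q)) \<le> card {C. C \<subseteq> Q \<and> card C = t}"
    using fin by (intro card_mono) (auto simp: t_chains_def)
  ultimately show ?thesis by simp
qed

section \<open>The extremal numbers\<close>

lemma finite_chain_counts:
  "finite {card (t_chains t Q (incl Q)) | Q. Q \<subseteq> boolean_lattice n \<and> p Q}"
  by (rule finite_subset[of _ "(\<lambda>Q. card (t_chains t Q (incl Q))) ` Pow (boolean_lattice n)"])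
    (auto simp: boolean_lattice_def)

lemma strong_embedding_imp_weak: "strong_embedding f P r Q s \<Longrightarrow> weak_embedding f P r Q s"
  by (simp add: strong_embedding_def weak_embedding_def)

lemma weakly_free_imp_strongly_free: "weakly_free P r Q s \<Longrightarrow> strongly_free P r Q s"
  using strong_embedding_imp_weak unfolding weakly_free_def strongly_free_def by metis

text \<open>
  The empty family has width \<open>0\<close> and is free of every nonempty poset, so the maxima that define
  \<open>RT\<close> and \<open>RT_sharp\<close> are taken over nonempty sets.
\<close>

lemma weakly_free_empty: "P \<noteq> {} \<Longrightarrow> weakly_free P r {} s"
  by (simp add: weakly_free_def weak_embedding_def)

lemma RT_le_RT_sharp:
  assumes "P \<noteq> {}" "l > 0"
  shows "RT n P r l t \<le> RT_sharp n P r l t"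
  unfolding RT_def RT_sharp_def
proof (rule Max_mono)
  show "{card (t_chains t Q (incl Q)) |Q.
          Q \<subseteq> boolean_lattice n \<and> weakly_free P r Q (incl Q) \<and> width Q (incl Q) < l}
      \<subseteq> {card (t_chains t Q (incl Q)) |Q.
          Q \<subseteq> boolean_lattice n \<and> strongly_free P r Q (incl Q) \<and> width Q (incl Q) < l}"
    using weakly_free_imp_strongly_free by blast
  show "{card (t_chains t Q (incl Q)) |Q.
          Q \<subseteq> boolean_lattice n \<and> weakly_free P r Q (incl Q) \<and> width Q (incl Q) < l} \<noteq> {}"
    using weakly_free_empty[OF assms(1)] assms(2) by (auto simp: width_empty intro!: exI[of _ "{}"])
qed (rule finite_chain_counts)

lemma RT_sharp_le:
  assumes "P \<noteq> {}" "l > 0" "t > 0"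
  shows "RT_sharp n P r l t \<le>
           (\<Sum>i=1..min t (l - 1). ((l - 1) choose i) * ((i * (n + 1)) choose t))"
  unfolding RT_sharp_def
proof (rule Max.boundedI)
  show "{card (t_chains t Q (incl Q)) |Q.
          Q \<subseteq> boolean_lattice n \<and> strongly_free P r Q (incl Q) \<and> width Q (incl Q) < l} \<noteq> {}"
    using weakly_free_imp_strongly_free[OF weakly_free_empty[OF assms(1)]] assms(2)
    by (auto simp: width_empty intro!: exI[of _ "{}"])
qed (use finite_chain_counts card_t_chains_le assms in auto)

section \<open>Asymptotics\<close>

text \<open>
  In the binomial expansion every power of \<open>n\<close> below the top one is at most \<open>n ^ (t - 1)\<close>, and
  the binomial coefficients add up to \<open>2 ^ t\<close>.
\<close>

lemma Suc_power_le:
  assumes "n > 0" "t > 0"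
  shows "real (n + 1) ^ t \<le> real n ^ t + 2 ^ t * real n ^ (t - 1)"
proof -
  obtain d where t: "t = Suc d" using assms by (cases t) auto
  have "real (n + 1) ^ t = (\<Sum>k\<le>t. real (t choose k) * real n ^ k)"
    using binomial_ring[of "real n" 1 t] by (simp add: add.commute)
  also have "\<dots> = real n ^ t + (\<Sum>k\<le>d. real (t choose k) * real n ^ k)"
    by (simp add: t)
  also have "(\<Sum>k\<le>d. real (t choose k) * real n ^ k) \<le> (\<Sum>k\<le>d. real (t choose k) * real n ^ d)"
    using assms by (intro sum_mono mult_left_mono power_increasing) auto
  also have "\<dots> = real (\<Sum>k\<le>d. t choose k) * real n ^ d"
    by (simp add: sum_distrib_right)
  also have "\<dots> \<le> real (\<Sum>k\<le>t. t choose k) * real n ^ d"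
    by (intro mult_right_mono of_nat_mono sum_mono2) (auto simp: t)
  also have "\<dots> = 2 ^ t * real n ^ (t - 1)" unfolding choose_row_sum by (simp add: t)
  finally show ?thesis by simp
qed

lemma choose_mult_Suc_le:
  assumes "n > 0" "t > 0"
  shows "real ((i * (n + 1)) choose t) \<le>
           real i ^ t / fact t * (real n ^ t + 2 ^ t * real n ^ (t - 1))"
proof -
  have "real (((i * (n + 1)) choose t) * fact t) \<le> real ((i * (n + 1)) ^ t)"
    by (intro of_nat_mono binomial_fact_pow)
  also have "\<dots> = real i ^ t * real (n + 1) ^ t"
    by (simp only: of_nat_power of_nat_mult power_mult_distrib)
  finally have "real ((i * (n + 1)) choose t) \<le> real i ^ t / fact t * real (n + 1) ^ t"
    by (simp add: field_simps)
  also have "\<dots> \<le> real i ^ t / fact t * (real n ^ t + 2 ^ t * real n ^ (t - 1))"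
    by (intro mult_left_mono Suc_power_le assms) auto
  finally show ?thesis .
qed

text \<open>
  The explicit error term shows that the constant hidden in \<open>O(n ^ (t - 1))\<close> may be taken as \<open>2 ^ t\<close>
  times the leading coefficient.
\<close>

lemma RT_sharp_asymptotic_le:
  fixes P :: "'a set"
  assumes "P \<noteq> {}" "l > 0" "t > 0" "n > 0"
  defines "c \<equiv> 1 / fact t * (\<Sum>i=1..min t (l - 1). real ((l - 1) choose i) * real i ^ t)"
  shows "real (RT_sharp n P r l t) \<le> c * real n ^ t + c * 2 ^ t * real n ^ (t - 1)"
proof -
  let ?b = "real n ^ t + 2 ^ t * real n ^ (t - 1)"
  have "real (RT_sharp n P r l t) \<le>
      (\<Sum>i=1..min t (l - 1). real ((l - 1) choose i) * real ((i * (n + 1)) choose t))"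
    using of_nat_mono[OF RT_sharp_le[OF assms(1-3)], where 'a=real] by simp
  also have "\<dots> \<le> (\<Sum>i=1..min t (l - 1). real ((l - 1) choose i) * (real i ^ t / fact t * ?b))"
    by (intro sum_mono mult_left_mono choose_mult_Suc_le assms) auto
  also have "\<dots> = c * ?b"
    by (simp add: c_def sum_distrib_left sum_distrib_right mult.assoc)
  finally show ?thesis by (simp add: algebra_simps)
qed

theorem theorem1p1:
  fixes P :: "'a set" and r :: "'a rel" and l :: nat
  assumes "finite P" and "P \<noteq> {}" and "partial_order_on P r" and "l > 0"
  shows "(\<forall>t>0. \<forall>n>0.
            RT n P r l t \<le> RT_sharp n P r l t \<and>
            RT_sharp n P r l t \<le>
              (if l = 1 then 0
               else \<Sum>i=1..min t (l - 1). ((l - 1) choose i) * ((i * (n + 1)) choose t)))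
       \<and> (\<forall>t>0. \<exists>g :: nat \<Rightarrow> real. g \<in> O(\<lambda>n. real n ^ (t - 1)) \<and>
            (\<forall>n>0. real (RT_sharp n P r l t) \<le>
               (1 / fact t * (\<Sum>i=1..min t (l - 1). real ((l - 1) choose i) * real i ^ t)) * real n ^ t
               + g n))
       \<and> (\<exists>g :: nat \<Rightarrow> real. g \<in> O(\<lambda>n. 1) \<and>
            (\<forall>n>0. real (RT_sharp n P r l 1) \<le> real (l - 1) * real n + g n))"
proof (intro conjI allI impI)
  fix t n :: nat assume "t > 0" "n > 0"
  show "RT n P r l t \<le> RT_sharp n P r l t" using assms by (intro RT_le_RT_sharp)
  show "RT_sharp n P r l t \<le>
      (if l = 1 then 0
       else \<Sum>i=1..min t (l - 1). ((l - 1) choose i) * ((i * (n + 1)) choose t))"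
    using RT_sharp_le[OF assms(2,4) \<open>t > 0\<close>, of n r] by (cases "l = 1") auto
next
  fix t :: nat assume "t > 0"
  define c :: real
    where "c = 1 / fact t * (\<Sum>i=1..min t (l - 1). real ((l - 1) choose i) * real i ^ t)"
  have "(\<lambda>n. c * 2 ^ t * real n ^ (t - 1)) \<in> O(\<lambda>n. real n ^ (t - 1))" by simp
  moreover have "\<forall>n>0. real (RT_sharp n P r l t) \<le> c * real n ^ t + c * 2 ^ t * real n ^ (t - 1)"
    using RT_sharp_asymptotic_le[OF assms(2,4) \<open>t > 0\<close>] unfolding c_def by blast
  ultimately show "\<exists>g :: nat \<Rightarrow> real. g \<in> O(\<lambda>n. real n ^ (t - 1)) \<and>
      (\<forall>n>0. real (RT_sharp n P r l t) \<le>
         (1 / fact t * (\<Sum>i=1..min t (l - 1). real ((l - 1) choose i) * real i ^ t)) * real n ^ t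
         + g n)"
    unfolding c_def by (intro exI conjI)
next
  have "RT_sharp n P r l 1 \<le> (l - 1) * (n + 1)" for n
  proof (cases "l = 1")
    case False
    then have "min 1 (l - 1) = 1" using assms(4) by simp
    then show ?thesis using RT_sharp_le[OF assms(2,4), of 1 n r] by simp
  qed (use RT_sharp_le[OF assms(2,4), of 1 n r] in simp)
  then have "real (RT_sharp n P r l 1) \<le> real ((l - 1) * (n + 1))" for n
    by (rule of_nat_mono)
  then have "\<forall>n>0. real (RT_sharp n P r l 1) \<le> real (l - 1) * real n + real (l - 1)"
    unfolding of_nat_mult of_nat_add of_nat_1 distrib_left mult_1_right by blast
  moreover have "(\<lambda>n. real (l - 1)) \<in> O(\<lambda>n. 1)" by simp
  ultimately show "\<exists>g :: nat \<Rightarrow> real. g \<in> O(\<lambda>n. 1) \<and>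
      (\<forall>n>0. real (RT_sharp n P r l 1) \<le> real (l - 1) * real n + g n)"
    by (intro exI conjI)
qed

end
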